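(* Let $f:\mathbb{R}^n\to\mathbb{R}$ be $L$-smooth (not necessarily convex) with finite infimum $f^\star$. Let $\mathcal{P}\subseteq\mathbb{R}^{n\times n}$ be a closed convex set and run the algorithm described in the context (Monotone Lookahead OSGM-H for nonconvex optimization) with $\eta=\tfrac1{2L}$. Then for every $K\ge1$ and any benchmark stepsize $\hat P\in\mathcal{P}$: (i) whenever the denominator below is positive, $$\min_{1\le k\le K}\|\nabla f(x^k)\|^2\le\frac{f(x^1)-f^\star}{K}\cdot\frac{1}{\frac1K\sum_{k=1}^K\big[-h_{x^k}(\hat P)-\frac{\lambda_k}{2}\|\hat P-\frac1LI\|_F^2\big]-\frac LK\|P_1-\hat P\|_F^2};$$ (ii) if $f$ is in addition $\mu$-PL, $$f(x^{K+1})-f^\star\le[f(x^1)-f^\star]\Big(1-2\mu\max\Big\{\tfrac1K\sum_{k=1}^K\big[-h_{x^k}(\hat P)-\tfrac{\lambda_k}2\|\hat P-\tfrac1LI\|_F^2\big]-\tfrac LK\|P_1-\hat P\|_F^2,\,0\Big\}\Big)^K.$$ In particular, if $P_1=\tfrac1LI$, then $\min_{1\le k\le K}\|\nabla f(x^k)\|^2\le\frac{2L[f(x^1)-f^\star]}{K}$ and, if $f$ is $\mu$-PL, $f(x^{K+1})-f^\star\le[f(x^1)-f^\star](1-\tfrac1\kappa)^K$ with $\kappa=L/\mu$.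
   Context: $L$-smooth means $\nabla f$ is $L$-Lipschitz. $f$ is $\mu$-PL if $f(x)-f^\star\le\frac1{2\mu}\|\nabla f(x)\|^2$ for all $x$. For $x$ with $\nabla f(x)\ne0$, the hypergradient feedback and its regularization ($\lambda\ge0$) are $$h_x(P)=\frac{f(x-P\nabla f(x))-f(x)}{\|\nabla f(x)\|^2},\qquad h_x^\lambda(P)=h_x(P)+\tfrac\lambda2\big\|P-\tfrac1LI\big\|_F^2 .$$ Algorithm. Input: $x^1$, $P_1\in\mathcal{P}$, $\eta>0$. For $k=1,2,\dots$: 1. $x^{k+1/2}=x^k-P_k\nabla f(x^k)$; 2. choose any $x^{k+1}$ with $f(x^{k+1})\le\min\{f(x^{k+1/2}-\tfrac1L\nabla f(x^{k+1/2})),\,f(x^k)\}$; 3. choose $0\le\lambda_k\le L$ such that $h_{x^k}^{\lambda_k}$ is convex on $\mathcal{P}$; 4. $P_{k+1}=\Pi_{\mathcal{P}}[P_k-\eta\nabla h_{x^k}^{\lambda_k}(P_k)]$, where $\Pi_{\mathcal{P}}$ is the orthogonal projection in Frobenius norm. It is assumed that $\nabla f(x^k)\neq0$ for $1\le k\le K$. *)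

theory Defs
  imports "HOL-Analysis.Analysis"
begin

text \<open>
  On \<open>real ^ 'n ^ 'n\<close> the library's \<open>inner\<close>, \<open>norm\<close> and \<open>dist\<close> are those of
  \<open>\<real>\<close>-vectors of \<open>\<real>\<close>-vectors, i.e. the Frobenius ones (see \<open>norm_matrix_eq_Frobenius\<close>).
  Hence \<open>gradient\<close> applies to functions of a vector and of a matrix alike, and \<open>closest_point\<close>
  on a set of matrices is the orthogonal projection in Frobenius norm.
\<close>

lemma norm_matrix_eq_Frobenius:
  fixes A :: "real ^ 'm ^ 'n"
  shows "norm A = sqrt (\<Sum>i\<in>UNIV. \<Sum>j\<in>UNIV. (A $ i $ j)\<^sup>2)"
  by (simp add: norm_vec_def L2_set_def sum_nonneg)

text \<open>Meaningful only where the function is differentiable.\<close>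

definition gradient :: "('a::real_inner \<Rightarrow> real) \<Rightarrow> 'a \<Rightarrow> 'a" where
  "gradient f x = (THE g. GDERIV f x :> g)"

lemma gradient_eqI:
  assumes "GDERIV f x :> g"
  shows "gradient f x = g"
  unfolding gradient_def
proof (rule the_equality)
  fix g' assume "GDERIV f x :> g'"
  then have "(\<lambda>h. inner h g') = (\<lambda>h. inner h g)"
    using assms unfolding gderiv_def by (rule has_derivative_unique)
  then have "inner (g' - g) g' = inner (g' - g) g"
    by metis
  then show "g' = g"
    by (metis inner_diff_right inner_eq_zero_iff right_minus_eq)
qed (fact assms)

definition L_smooth :: "real \<Rightarrow> ('a::real_inner \<Rightarrow> real) \<Rightarrow> bool" where
  "L_smooth L f \<longleftrightarrow> (\<forall>x. f differentiable (at x)) \<and> L-lipschitz_on UNIV (gradient f)"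

definition PL :: "real \<Rightarrow> ('a::real_inner \<Rightarrow> real) \<Rightarrow> bool" where
  "PL \<mu> f \<longleftrightarrow> (\<forall>x. f x - (INF y. f y) \<le> 1 / (2 * \<mu>) * (norm (gradient f x))\<^sup>2)"

text \<open>Meaningful only where \<open>gradient f x \<noteq> 0\<close>.\<close>

definition hyper :: "(real ^ 'n \<Rightarrow> real) \<Rightarrow> real ^ 'n \<Rightarrow> real ^ 'n ^ 'n \<Rightarrow> real" where
  "hyper f x P = (f (x - P *v gradient f x) - f x) / (norm (gradient f x))\<^sup>2"

definition hyper_reg ::
    "(real ^ 'n \<Rightarrow> real) \<Rightarrow> real \<Rightarrow> real \<Rightarrow> real ^ 'n \<Rightarrow> real ^ 'n ^ 'n \<Rightarrow> real" where
  "hyper_reg f L lam x P = hyper f x P + lam / 2 * (norm (P - (1 / L) *\<^sub>R mat 1))\<^sup>2"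

text \<open>
  Iterations \<open>1, \<dots>, K\<close> of the algorithm. The choices of \<open>x (Suc k)\<close> and \<open>lam k\<close> are left
  nondeterministic, so the iterates \<open>x\<close>, \<open>P\<close> and the weights \<open>lam\<close> are related by a predicate.
  Sequences are indexed from \<open>1\<close>; the values at \<open>0\<close> are irrelevant.
\<close>

definition lookahead_OSGM_run ::
    "(real ^ 'n \<Rightarrow> real) \<Rightarrow> real \<Rightarrow> (real ^ 'n ^ 'n) set \<Rightarrow> real \<Rightarrow> nat \<Rightarrow>
     (nat \<Rightarrow> real ^ 'n) \<Rightarrow> (nat \<Rightarrow> real ^ 'n ^ 'n) \<Rightarrow> (nat \<Rightarrow> real) \<Rightarrow> bool" where
  "lookahead_OSGM_run f L \<P> \<eta> K x P lam \<longleftrightarrow>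
     P 1 \<in> \<P> \<and>
     (\<forall>k\<in>{1..K}.
        (let y = x k - P k *v gradient f (x k)
         in f (x (Suc k)) \<le> min (f (y - (1 / L) *\<^sub>R gradient f y)) (f (x k))) \<and>
        0 \<le> lam k \<and> lam k \<le> L \<and> convex_on \<P> (hyper_reg f L (lam k) (x k)) \<and>
        P (Suc k) = closest_point \<P> (P k - \<eta> *\<^sub>R gradient (hyper_reg f L (lam k) (x k)) (P k)))"

end

theory Submission
  imports Defs
begin

text \<open>
  Let \<open>s\<^sub>k = (f(x\<^sup>k) - f(x\<^sup>k\<^sup>+\<^sup>1)) / \<parallel>\<nabla>f(x\<^sup>k)\<parallel>\<^sup>2 \<ge> 0\<close>. The lookahead gradient step decreases \<open>f\<close> by
  \<open>\<parallel>\<nabla>f(x\<^sup>k\<^sup>+\<^sup>1\<^sup>/\<^sup>2)\<parallel>\<^sup>2 / 2L\<close>, and \<open>\<parallel>\<nabla>f(x\<^sup>k\<^sup>+\<^sup>1\<^sup>/\<^sup>2)\<parallel> / \<parallel>\<nabla>f(x\<^sup>k)\<parallel>\<close> is the Frobenius norm of the gradient of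
  the hypergradient feedback. This decrease, together with the regularizer and \<open>\<lambda>\<^sub>k \<le> L\<close>, absorbs
  the second-order term of projected online gradient descent with step \<open>1 / 2L\<close>. The
  regret bound therefore telescopes and bounds \<open>\<Sum>s\<^sub>k\<close> from below. Part (i) follows by telescoping
  \<open>f(x\<^sup>k)\<close>; part (ii) follows from the contraction factors \<open>1 - 2\<mu>s\<^sub>k\<close> by the arithmetic-geometric
  mean inequality.
\<close>

section \<open>Gradients, tangent bounds and descent for smooth functions\<close>

lemma gderiv_gradient:
  fixes f :: "'a::euclidean_space \<Rightarrow> real"
  assumes "f differentiable (at x)"
  shows "GDERIV f x :> gradient f x"
proof -
  obtain f' where f': "(f has_derivative f') (at x)"
    using assms by (auto simp: differentiable_def)
  interpret bounded_linear f' by (rule has_derivative_bounded_linear[OF f'])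
  \<comment> \<open>Riesz representation: the representing vector has the values of
    \<open>f'\<close> on the basis as coordinates.\<close>
  have "f' h = inner h (\<Sum>b\<in>Basis. f' b *\<^sub>R b)" for h
  proof -
    have "f' h = f' (\<Sum>b\<in>Basis. inner h b *\<^sub>R b)"
      by (simp only: euclidean_representation)
    then show ?thesis
      by (simp add: sum scaleR inner_sum_right mult.commute)
  qed
  then have "f' = (\<lambda>h. inner h (\<Sum>b\<in>Basis. f' b *\<^sub>R b))" by blast
  then have "GDERIV f x :> (\<Sum>b\<in>Basis. f' b *\<^sub>R b)"
    using f' by (simp add: gderiv_def)
  then show ?thesis using gradient_eqI by metis
qed

lemma gderiv_along_line:
  fixes f :: "'a::real_inner \<Rightarrow> real"
  assumes "GDERIV f (x + t *\<^sub>R d) :> g"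
  shows "((\<lambda>t. f (x + t *\<^sub>R d)) has_real_derivative inner d g) (at t)"
proof -
  have "((\<lambda>t. x + t *\<^sub>R d) has_derivative (\<lambda>s. s *\<^sub>R d)) (at t)"
    by (auto intro!: derivative_eq_intros)
  from has_derivative_compose[OF this assms[unfolded gderiv_def]]
  show ?thesis by (simp add: has_field_derivative_def mult_commute_abs)
qed

lemma convex_on_above_tangent:
  fixes f :: "'a::real_inner \<Rightarrow> real"
  assumes "convex_on S f" "GDERIV f x :> g" "x \<in> S" "y \<in> S"
  shows "f x + inner (y - x) g \<le> f y"
proof -
  have "((\<lambda>t. f (x + t *\<^sub>R (y - x))) has_real_derivative inner (y - x) g) (at 0)"
    by (rule gderiv_along_line) (simp add: assms)
  then have lim: "((\<lambda>t. (f (x + t *\<^sub>R (y - x)) - f x) / t) \<longlongrightarrow> inner (y - x) g) (at_right 0)"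
    by (simp add: has_field_derivative_iff filterlim_at_split)
  \<comment> \<open>Convexity controls \<open>f\<close> only on the segment inside \<open>S\<close>,
    so the quotient is taken from the right: for 0 < t < 1 it is at most \<open>f y - f x\<close>,
    and the bound passes to the limit.\<close>
  have "\<forall>\<^sub>F t in at_right 0. (f (x + t *\<^sub>R (y - x)) - f x) / t \<le> f y - f x"
    unfolding eventually_at_right_field
  proof (intro exI[of _ 1] conjI allI impI)
    fix t :: real assume t: "0 < t" "t < 1"
    have "x + t *\<^sub>R (y - x) = (1 - t) *\<^sub>R x + t *\<^sub>R y" by (simp add: algebra_simps)
    then have "f (x + t *\<^sub>R (y - x)) \<le> (1 - t) * f x + t * f y"
      using convex_onD[OF assms(1), of t x y] t assms by simp
    then show "(f (x + t *\<^sub>R (y - x)) - f x) / t \<le> f y - f x"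
      using t by (simp only: pos_divide_le_eq) (simp add: algebra_simps)
  qed simp
  from tendsto_upperbound[OF lim this] show ?thesis by simp
qed

lemma descent_lemma:
  fixes f :: "'a::euclidean_space \<Rightarrow> real"
  assumes "L_smooth L f"
  shows "f (x + d) \<le> f x + inner d (gradient f x) + L / 2 * (norm d)\<^sup>2"
proof -
  \<comment> \<open>\<open>f\<close> along the segment, with the linear and quadratic terms of its
    upper model removed. The Lipschitz bound on the gradient makes the derivative nonpositive on
    [0, 1].\<close>
  define \<phi> where "\<phi> t = f (x + t *\<^sub>R d) - t * inner d (gradient f x) - L / 2 * t\<^sup>2 * (norm d)\<^sup>2" for t
  have "\<phi> 1 \<le> \<phi> 0"
  proof (rule DERIV_nonpos_imp_nonincreasing[of 0 1 \<phi>])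
    fix t :: real assume t: "0 \<le> t" "t \<le> 1"
    let ?g = "gradient f (x + t *\<^sub>R d)"
    have "GDERIV f (x + t *\<^sub>R d) :> ?g"
      using assms by (auto simp: L_smooth_def intro: gderiv_gradient)
    note [derivative_intros] = gderiv_along_line[OF this]
    have "(\<phi> has_real_derivative inner d ?g - inner d (gradient f x) - L * t * (norm d)\<^sup>2) (at t)"
      unfolding \<phi>_def by (auto intro!: derivative_eq_intros)
    moreover have "dist ?g (gradient f x) \<le> L * dist (x + t *\<^sub>R d) x"
      using assms by (auto simp: L_smooth_def intro: lipschitz_onD)
    then have "norm d * norm (?g - gradient f x) \<le> norm d * (L * (t * norm d))"
      using t by (intro mult_left_mono) (auto simp: dist_norm)
    with norm_cauchy_schwarz[of d "?g - gradient f x"]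
    have "inner d ?g - inner d (gradient f x) - L * t * (norm d)\<^sup>2 \<le> 0"
      by (simp add: inner_diff_right power2_eq_square algebra_simps)
    ultimately show "\<exists>y. (\<phi> has_real_derivative y) (at t) \<and> y \<le> 0" by blast
  qed simp
  then show ?thesis by (simp add: \<phi>_def)
qed

lemma gradient_step_descent:
  fixes f :: "'a::euclidean_space \<Rightarrow> real"
  assumes "L_smooth L f" "L > 0"
  shows "f (x - (1 / L) *\<^sub>R gradient f x) \<le> f x - (norm (gradient f x))\<^sup>2 / (2 * L)"
proof -
  let ?g = "gradient f x"
  have "f (x - (1 / L) *\<^sub>R ?g) \<le> f x - 1 / L * (norm ?g)\<^sup>2 + L / 2 * (1 / L * norm ?g)\<^sup>2"
    using descent_lemma[OF assms(1), of x "- ((1 / L) *\<^sub>R ?g)"] assms(2)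
    by (simp add: power2_norm_eq_inner[of ?g])
  also have "\<dots> = f x - (norm ?g)\<^sup>2 / (2 * L)"
    using assms(2) by (simp add: field_simps power2_eq_square)
  finally show ?thesis .
qed

section \<open>Rank-one matrices and the gradient of the hypergradient feedback\<close>

definition outer :: "real ^ 'm \<Rightarrow> real ^ 'n \<Rightarrow> real ^ 'n ^ 'm" where
  "outer u v = (\<chi> i j. u $ i * v $ j)"

text \<open>Makes \<open>outer u v\<close> the gradient of the linear map
  \<open>\<lambda>A. inner u (A *v v)\<close>; this is how rank-one matrices enter the gradient of
  the feedback.\<close>

lemma inner_outer: "inner A (outer u v) = inner u (A *v v)"
  by (simp add: inner_vec_def outer_def matrix_vector_mult_def sum_distrib_left mult_ac)

lemma norm_outer: "norm (outer u v) = norm u * norm v"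
proof -
  \<comment> \<open>By \<open>inner_outer\<close>, pairing \<open>outer u v\<close> with itself
    reduces to this product.\<close>
  have "outer u v *v v = (norm v)\<^sup>2 *\<^sub>R u"
    by (simp add: vec_eq_iff outer_def matrix_vector_mult_def power2_norm_eq_inner inner_vec_def
        sum_distrib_left mult_ac)
  then have "(norm (outer u v))\<^sup>2 = (norm u * norm v)\<^sup>2"
    by (simp add: power2_norm_eq_inner[of "outer u v"] inner_outer power_mult_distrib
        power2_norm_eq_inner[of u])
  then show ?thesis by (simp add: power2_eq_iff_nonneg)
qed

text \<open>Chain rule: a direction \<open>H\<close> moves the evaluation point by minus
  \<open>H *v gradient f x\<close>, and \<open>inner_outer\<close> turns the resulting inner product
  of vectors into a Frobenius one.\<close>

lemma gderiv_hyper_reg: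
  fixes f :: "real ^ 'n \<Rightarrow> real"
  assumes "f differentiable (at (x - P *v gradient f x))"
  shows "GDERIV (hyper_reg f L lam x) P :>
    lam *\<^sub>R (P - (1 / L) *\<^sub>R mat 1)
      - (1 / (norm (gradient f x))\<^sup>2) *\<^sub>R outer (gradient f (x - P *v gradient f x)) (gradient f x)"
proof -
  let ?g = "gradient f x"
  let ?y = "x - P *v ?g"
  have "bounded_linear (\<lambda>Q::real^'n^'n. Q *v ?g)"
    unfolding linear_conv_bounded_linear[symmetric]
    by (rule linearI) (simp_all add: matrix_vector_mult_add_rdistrib scaleR_matrix_vector_assoc)
  note [derivative_intros] = bounded_linear.has_derivative[OF this]
  have "((\<lambda>Q. x - Q *v ?g) has_derivative (\<lambda>H. - (H *v ?g))) (at P)"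
    by (auto intro!: derivative_eq_intros)
  from has_derivative_compose[OF this gderiv_gradient[OF assms, unfolded gderiv_def]]
  have [derivative_intros]: "((\<lambda>Q. f (x - Q *v ?g)) has_derivative (\<lambda>H. inner (- (H *v ?g)) (gradient f ?y))) (at P)" .
  define c where "c = 1 / (norm ?g)\<^sup>2"
  define M where "M = (1 / L) *\<^sub>R (mat 1 :: real ^ 'n ^ 'n)"
  \<comment> \<open>As an inner product, the squared norm can be differentiated also at
    \<open>Q = M\<close>, where the norm itself cannot.\<close>
  have "hyper_reg f L lam x = (\<lambda>Q. c * (f (x - Q *v ?g) - f x) + lam / 2 * inner (Q - M) (Q - M))"
    by (simp add: hyper_reg_def hyper_def c_def M_def power2_norm_eq_inner[symmetric] fun_eq_iff)
  moreover have "((\<lambda>Q. c * (f (x - Q *v ?g) - f x) + lam / 2 * inner (Q - M) (Q - M))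
      has_derivative (\<lambda>H. inner H (lam *\<^sub>R (P - M) - c *\<^sub>R outer (gradient f ?y) ?g))) (at P)"
    by (auto intro!: derivative_eq_intros
        simp: inner_outer inner_diff_right inner_diff_left inner_commute algebra_simps)
  ultimately show ?thesis by (simp add: gderiv_def c_def M_def)
qed

section \<open>Projected steps, averages and the progress of one iteration\<close>

lemma projected_step_le:
  fixes S :: "'a::euclidean_space set"
  assumes "closed S" "convex S" "q \<in> S"
  shows "(norm (closest_point S (p - \<eta> *\<^sub>R g) - q))\<^sup>2
    \<le> (norm (p - q))\<^sup>2 - 2 * \<eta> * inner (p - q) g + \<eta>\<^sup>2 * (norm g)\<^sup>2"
proof -
  \<comment> \<open>Projection is nonexpansive and fixes \<open>q\<close>.\<close>
  have "dist (closest_point S (p - \<eta> *\<^sub>R g)) (closest_point S q) \<le> dist (p - \<eta> *\<^sub>R g) q"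
    using assms by (intro closest_point_lipschitz) auto
  then have "(norm (closest_point S (p - \<eta> *\<^sub>R g) - q))\<^sup>2 \<le> (norm ((p - q) - \<eta> *\<^sub>R g))\<^sup>2"
    using assms by (simp add: closest_point_self dist_norm power_mono algebra_simps)
  also have "\<dots> = (norm (p - q))\<^sup>2 - 2 * \<eta> * inner (p - q) g + \<eta>\<^sup>2 * (norm g)\<^sup>2"
    unfolding power2_norm_eq_inner by (simp add: inner_simps inner_commute power2_eq_square algebra_simps)
  finally show ?thesis .
qed

lemma prod_le_mean_power:
  fixes a :: "'i \<Rightarrow> real"
  assumes "finite S" "S \<noteq> {}" "\<And>i. i \<in> S \<Longrightarrow> a i \<ge> 0"
  shows "prod a S \<le> (sum a S / card S) ^ card S"
proof -
  have "card S > 0" using assms by (simp add: card_gt_0_iff)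
  have "prod a S powr (1 / card S) \<le> sum a S / card S"
    using arith_geom_mean[OF assms(1,2), of a] assms(3) by (simp add: sum_divide_distrib)
  then have "(prod a S powr (1 / card S)) ^ card S \<le> (sum a S / card S) ^ card S"
    by (rule power_mono) simp
  \<comment> \<open>A vanishing product is a separate case: there \<open>powr\<close> returns 0,
    whose power is 0 since \<open>card S > 0\<close>.\<close>
  moreover have "(prod a S powr (1 / card S)) ^ card S = prod a S"
    using \<open>card S > 0\<close> prod_nonneg[of S a] assms(3)
    by (cases "prod a S = 0") (simp_all add: powr_realpow[symmetric] powr_powr)
  ultimately show ?thesis by simp
qed

text \<open>One step of the regret bound, with the realized decrease in place of the feedback at
  \<open>p\<close>. The quadratic error of the projected step splits in two: the feedback part is
  paid by the extra gradient step from \<open>y\<close>, the regularizer part by the value of the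
  regularizer at \<open>p\<close>.\<close>

lemma lookahead_step_progress:
  fixes f :: "real ^ 'n \<Rightarrow> real" and p q :: "real ^ 'n ^ 'n"
  assumes L: "L > 0" "L_smooth L f" and S: "closed S" "convex S" "p \<in> S" "q \<in> S"
    and g0: "gradient f x \<noteq> 0" and lam: "0 \<le> lam" "lam \<le> L"
    and conv: "convex_on S (hyper_reg f L lam x)"
    and y: "y = x - p *v gradient f x"
    and x': "f x' \<le> f (y - (1 / L) *\<^sub>R gradient f y)"
    and p': "p' = closest_point S (p - (1 / (2 * L)) *\<^sub>R gradient (hyper_reg f L lam x) p)"
  shows "- hyper f x q - lam / 2 * (norm (q - (1 / L) *\<^sub>R mat 1))\<^sup>2
      + L * ((norm (p' - q))\<^sup>2 - (norm (p - q))\<^sup>2) \<le> (f x - f x') / (norm (gradient f x))\<^sup>2"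
proof -
  let ?g = "gradient f x" and ?I = "(1 / L) *\<^sub>R (mat 1 :: real ^ 'n ^ 'n)"
  let ?N = "(norm ?g)\<^sup>2"
  define G where "G = (1 / ?N) *\<^sub>R outer (gradient f y) ?g"
  define R where "R = lam *\<^sub>R (p - ?I)"
  have diff: "f differentiable (at y)" using L by (simp add: L_smooth_def)
  then have D: "GDERIV (hyper_reg f L lam x) p :> R - G"
    unfolding G_def R_def y by (rule gderiv_hyper_reg)
  have N: "?N > 0" using g0 by simp
  \<comment> \<open>The norm of \<open>G\<close> is the ratio of the gradient norms at
    \<open>y\<close> and \<open>x\<close>, so the decrease guaranteed at \<open>y\<close>, divided
    by \<open>?N\<close>, becomes a multiple of its square.\<close>
  have "(norm G)\<^sup>2 = (norm (gradient f y))\<^sup>2 / ?N"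
    using g0 by (simp add: G_def norm_outer power_mult_distrib power_divide field_simps power2_eq_square)
  moreover have "f x' \<le> f y - (norm (gradient f y))\<^sup>2 / (2 * L)"
    using x' gradient_step_descent[OF L(2,1), of y] by linarith
  then have "(f x' - f x) / ?N \<le> (f y - (norm (gradient f y))\<^sup>2 / (2 * L) - f x) / ?N"
    using N by (intro divide_right_mono) auto
  ultimately have prog: "(f x' - f x) / ?N \<le> hyper f x p - (norm G)\<^sup>2 / (2 * L)"
    by (simp add: hyper_def y[symmetric] diff_divide_distrib mult.commute)
  have conv': "hyper_reg f L lam x p - hyper_reg f L lam x q \<le> inner (p - q) (R - G)"
    using convex_on_above_tangent[OF conv D S(3,4)] by (simp add: inner_diff_left)
  have "(norm (p' - q))\<^sup>2 \<le> (norm (p - q))\<^sup>2 - 2 * (1 / (2 * L)) * inner (p - q) (R - G)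
      + (1 / (2 * L))\<^sup>2 * (norm (R - G))\<^sup>2"
    unfolding p' gradient_eqI[OF D] using S by (intro projected_step_le) auto
  \<comment> \<open>With step 1/(2L), scaling by \<open>L\<close> gives the inner product the
    coefficient 1, as in \<open>conv'\<close>, and leaves 1/(4L) on the squared norm.\<close>
  from mult_left_mono[OF this, of L]
  have "L * (norm (p' - q))\<^sup>2
      \<le> L * (norm (p - q))\<^sup>2 - inner (p - q) (R - G) + (norm (R - G))\<^sup>2 / (4 * L)"
    using L(1) by (simp add: algebra_simps power2_eq_square[of L] power_mult_distrib power_divide)
  then have proj: "L * ((norm (p' - q))\<^sup>2 - (norm (p - q))\<^sup>2)
      \<le> (norm (R - G))\<^sup>2 / (4 * L) - inner (p - q) (R - G)"
    by (simp add: right_diff_distrib)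
  \<comment> \<open>Parallelogram identity; the slack is the square of
    \<open>norm (R + G)\<close>.\<close>
  have "(norm (R - G))\<^sup>2 \<le> 2 * (norm R)\<^sup>2 + 2 * (norm G)\<^sup>2"
    using zero_le_power2[of "norm (R + G)"]
    unfolding power2_norm_eq_inner by (simp add: inner_simps inner_commute)
  then have "(norm (R - G))\<^sup>2 / (4 * L) \<le> (2 * (norm R)\<^sup>2 + 2 * (norm G)\<^sup>2) / (4 * L)"
    using L by (intro divide_right_mono) auto
  also have "\<dots> = (norm R)\<^sup>2 / (2 * L) + (norm G)\<^sup>2 / (2 * L)"
    using L by (simp add: field_simps)
  finally have split: "(norm (R - G))\<^sup>2 / (4 * L) \<le> (norm R)\<^sup>2 / (2 * L) + (norm G)\<^sup>2 / (2 * L)" .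
  \<comment> \<open>Here \<open>lam \<le> L\<close> lets the regularizer at \<open>p\<close>, left
    over in \<open>conv'\<close>, pay for the square of \<open>norm R\<close>.\<close>
  have "lam\<^sup>2 / (2 * L) \<le> lam / 2"
    using lam L mult_left_mono[OF lam(2,1)] by (simp add: field_simps power2_eq_square)
  from mult_right_mono[OF this, of "(norm (p - ?I))\<^sup>2"]
  have "(norm R)\<^sup>2 / (2 * L) \<le> lam / 2 * (norm (p - ?I))\<^sup>2"
    by (simp add: R_def power_mult_distrib)
  with split proj conv' prog
  have "- hyper f x q - lam / 2 * (norm (q - ?I))\<^sup>2 + L * ((norm (p' - q))\<^sup>2 - (norm (p - q))\<^sup>2)
      \<le> - ((f x' - f x) / ?N)"
    by (simp add: hyper_reg_def)
  then show ?thesis by (simp add: minus_divide_left)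
qed

text \<open>Chaining the steps gives the product of the factors \<open>1 - m * s k\<close>, which
  the arithmetic-geometric mean inequality bounds by a power of their mean. Any \<open>c\<close>
  below the mean of the \<open>s k\<close> then serves as a rate.\<close>

lemma mean_contraction:
  fixes a s :: "nat \<Rightarrow> real"
  assumes pos: "\<And>k. k \<in> {1..K} \<Longrightarrow> 0 < a k" and last: "0 \<le> a (Suc K)" and "K \<ge> 1" "m \<ge> 0"
    and step: "\<And>k. k \<in> {1..K} \<Longrightarrow> a (Suc k) \<le> a k * (1 - m * s k)"
    and c: "c \<le> (\<Sum>k=1..K. s k) / K"
  shows "a (Suc K) \<le> a 1 * (1 - m * c) ^ K"
proof -
  define w where "w k = 1 - m * s k" for k
  \<comment> \<open>The mean inequality needs nonnegative factors. Each follows from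
    \<open>a k > 0\<close> and \<open>a (Suc k) \<ge> 0\<close>; the index \<open>Suc K\<close> lies
    outside \<open>pos\<close> and is covered by \<open>last\<close>.\<close>
  have w: "0 \<le> w k" if "k \<in> {1..K}" for k
  proof -
    have "0 \<le> a (Suc k)"
    proof (cases "k = K")
      case False
      then show ?thesis using that pos[of "Suc k"] by simp
    qed (use last in simp)
    then have "0 \<le> a k * w k" using step[OF that] by (simp add: w_def)
    then show ?thesis using pos[OF that] by (simp add: zero_le_mult_iff)
  qed
  have "a (Suc n) \<le> a 1 * prod w {1..n}" if "n \<le> K" for n
    using that
  proof (induction n)
    case (Suc n)
    have "a (Suc (Suc n)) \<le> a (Suc n) * w (Suc n)"
      using step[of "Suc n"] Suc.prems by (simp add: w_def)
    also have "\<dots> \<le> (a 1 * prod w {1..n}) * w (Suc n)"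
      using Suc w[of "Suc n"] by (intro mult_right_mono) auto
    finally show ?case by (simp add: mult_ac)
  qed simp
  then have "a (Suc K) \<le> a 1 * prod w {1..K}" by simp
  also have "\<dots> \<le> a 1 * (sum w {1..K} / K) ^ K"
    using prod_le_mean_power[of "{1..K}" w] w pos[of 1] \<open>K \<ge> 1\<close> by (intro mult_left_mono) auto
  also have avg: "sum w {1..K} / K = 1 - m * ((\<Sum>k=1..K. s k) / K)"
    using \<open>K \<ge> 1\<close> by (simp add: w_def sum_subtractf sum_distrib_left[symmetric] field_simps)
  also have "a 1 * \<dots> ^ K \<le> a 1 * (1 - m * c) ^ K"
  proof (intro mult_left_mono power_mono)
    show "1 - m * ((\<Sum>k=1..K. s k) / K) \<le> 1 - m * c"
      using mult_left_mono[OF c \<open>m \<ge> 0\<close>] by simp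
    \<comment> \<open>Monotonicity of the power needs the smaller base, the mean of the factors, to
      be nonnegative.\<close>
    have "0 \<le> sum w {1..K} / K" using w by (intro divide_nonneg_nonneg sum_nonneg) auto
    then show "0 \<le> 1 - m * ((\<Sum>k=1..K. s k) / K)"
      unfolding avg .
    show "0 \<le> a 1" using pos[of 1] \<open>K \<ge> 1\<close> by simp
  qed
  finally show ?thesis .
qed

section \<open>Convergence bounds for the whole run\<close>

theorem theorem3p2:
  fixes f :: "real ^ 'n \<Rightarrow> real"
    and L :: real
    and \<P> :: "(real ^ 'n ^ 'n) set"
    and K :: nat
    and x :: "nat \<Rightarrow> real ^ 'n"
    and P :: "nat \<Rightarrow> real ^ 'n ^ 'n"
    and lam :: "nat \<Rightarrow> real"
  assumes "L > 0" and "L_smooth L f" and "bdd_below (range f)"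
    and "closed \<P>" and "convex \<P>"
    and "K \<ge> 1"
    and "lookahead_OSGM_run f L \<P> (1 / (2 * L)) K x P lam"
    and "\<forall>k\<in>{1..K}. gradient f (x k) \<noteq> 0"
  shows
    "(let fstar = (INF y. f y) in
      (\<forall>Phat\<in>\<P>.
         let D = 1 / real K *
                   (\<Sum>k=1..K. - hyper f (x k) Phat
                              - lam k / 2 * (norm (Phat - (1 / L) *\<^sub>R mat 1))\<^sup>2)
                 - L / real K * (norm (P 1 - Phat))\<^sup>2
         in (D > 0 \<longrightarrow>
               (MIN k\<in>{1..K}. (norm (gradient f (x k)))\<^sup>2) \<le> (f (x 1) - fstar) / real K * (1 / D)) \<and>
            (\<forall>\<mu>>0. PL \<mu> f \<longrightarrow>
               f (x (K + 1)) - fstar \<le> (f (x 1) - fstar) * (1 - 2 * \<mu> * max D 0) ^ K)) \<and>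
      (P 1 = (1 / L) *\<^sub>R mat 1 \<longrightarrow>
         (MIN k\<in>{1..K}. (norm (gradient f (x k)))\<^sup>2) \<le> 2 * L * (f (x 1) - fstar) / real K \<and>
         (\<forall>\<mu>>0. PL \<mu> f \<longrightarrow>
            (let \<kappa> = L / \<mu>
             in f (x (K + 1)) - fstar \<le> (f (x 1) - fstar) * (1 - 1 / \<kappa>) ^ K))))"
proof -
  define fstar where "fstar = (INF y. f y)"
  let ?I = "(1 / L) *\<^sub>R (mat 1 :: real ^ 'n ^ 'n)"
  define N where "N k = (norm (gradient f (x k)))\<^sup>2" for k
  define s where "s k = (f (x k) - f (x (Suc k))) / N k" for k
  define gain where "gain Q k = - hyper f (x k) Q - lam k / 2 * (norm (Q - ?I))\<^sup>2" for Q k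
  define D where "D Q = 1 / real K * (\<Sum>k=1..K. gain Q k) - L / real K * (norm (P 1 - Q))\<^sup>2" for Q
  define y where "y k = x k - P k *v gradient f (x k)" for k
  note L = \<open>L > 0\<close> \<open>L_smooth L f\<close>
  have K: "real K > 0" using \<open>K \<ge> 1\<close> by simp
  have P1: "P 1 \<in> \<P>"
    and run: "\<And>k. k \<in> {1..K} \<Longrightarrow> f (x (Suc k)) \<le> f (y k - (1 / L) *\<^sub>R gradient f (y k))
      \<and> f (x (Suc k)) \<le> f (x k) \<and> 0 \<le> lam k \<and> lam k \<le> L
      \<and> convex_on \<P> (hyper_reg f L (lam k) (x k))
      \<and> P (Suc k) = closest_point \<P> (P k - (1 / (2 * L)) *\<^sub>R gradient (hyper_reg f L (lam k) (x k)) (P k))"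
    using assms(7) by (auto simp: lookahead_OSGM_run_def Let_def y_def)
  have g0: "gradient f (x k) \<noteq> 0" if "k \<in> {1..K}" for k using assms(8) that by blast
  have N: "N k > 0" if "k \<in> {1..K}" for k using g0[OF that] by (simp add: N_def)
  have PP: "P k \<in> \<P>" if "k \<in> {1..K}" for k
  proof (cases "k = 1")
    case False
    then have "k = Suc (k - 1)" "k - 1 \<in> {1..K}" using that by auto
    then show ?thesis
      using run[of "k - 1"] P1 \<open>closed \<P>\<close> by (auto intro: closest_point_in_set)
  qed (use P1 in simp)
  have lower: "fstar \<le> f z" for z
    unfolding fstar_def using \<open>bdd_below (range f)\<close> by (rule cINF_lower) simp
  have s0: "0 \<le> s k" if "k \<in> {1..K}" for k
    using run[OF that] N[OF that] by (simp add: s_def)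
  have decrease: "f (x k) - f (x (Suc k)) = s k * N k" if "k \<in> {1..K}" for k
    using N[OF that] by (simp add: s_def)
  have D_le: "D Q \<le> (\<Sum>k=1..K. s k) / K" if "Q \<in> \<P>" for Q
  proof -
    define d where "d k = (norm (P k - Q))\<^sup>2" for k
    have "gain Q k + L * (d (Suc k) - d k) \<le> s k" if k: "k \<in> {1..K}" for k
      unfolding gain_def d_def s_def N_def
      by (rule lookahead_step_progress[where S = \<P> and y = "y k"])
        (use run[OF k] L \<open>closed \<P>\<close> \<open>convex \<P>\<close> PP[OF k] \<open>Q \<in> \<P>\<close> g0[OF k] in \<open>auto simp: y_def\<close>)
    then have "(\<Sum>k=1..K. gain Q k + L * (d (Suc k) - d k)) \<le> (\<Sum>k=1..K. s k)"
      by (rule sum_mono)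
    moreover have "(\<Sum>k=1..K. d (Suc k) - d k) = d (Suc K) - d 1"
      using \<open>K \<ge> 1\<close> by (simp add: sum_Suc_diff)
    ultimately have "(\<Sum>k=1..K. gain Q k) + L * (d (Suc K) - d 1) \<le> (\<Sum>k=1..K. s k)"
      by (simp add: sum.distrib sum_distrib_left[symmetric])
    \<comment> \<open>The final distance has the favourable sign and is dropped; the initial one
      becomes the \<open>L / real K\<close> term of \<open>D\<close>.\<close>
    moreover have "0 \<le> L * d (Suc K)" using L by (simp add: d_def)
    ultimately have "(\<Sum>k=1..K. gain Q k) - L * d 1 \<le> (\<Sum>k=1..K. s k)"
      by (simp add: right_diff_distrib)
    from divide_right_mono[OF this, of "real K"] K show ?thesis
      by (simp add: D_def d_def diff_divide_distrib)
  qed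
  \<comment> \<open>Kept general in \<open>c\<close> to serve both \<open>D Q\<close> and, when
    \<open>P 1 = ?I\<close>, the constant 1/(2L).\<close>
  have min_bound: "(MIN k\<in>{1..K}. N k) \<le> (f (x 1) - fstar) / real K * (1 / c)"
    if c: "0 < c" "c \<le> (\<Sum>k=1..K. s k) / K" for c
  proof -
    let ?m = "MIN k\<in>{1..K}. N k"
    have "?m \<in> N ` {1..K}" using \<open>K \<ge> 1\<close> by (intro Min_in) auto
    then have m0: "0 \<le> ?m" using N by force
    have "c * K * ?m \<le> (\<Sum>k=1..K. s k) * ?m"
      using c K m0 by (intro mult_right_mono) (auto simp: field_simps)
    also have "\<dots> \<le> (\<Sum>k=1..K. f (x k) - f (x (Suc k)))"
      unfolding sum_distrib_right
    proof (rule sum_mono)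
      fix k assume k: "k \<in> {1..K}"
      then have "?m \<le> N k" by (intro Min_le) auto
      then show "s k * ?m \<le> f (x k) - f (x (Suc k))"
        unfolding decrease[OF k] using s0[OF k] by (rule mult_left_mono)
    qed
    also have "\<dots> = f (x 1) - f (x (Suc K))"
      using sum_Suc_diff[of 1 K "\<lambda>k. - f (x k)"] \<open>K \<ge> 1\<close> by simp
    also have "\<dots> \<le> f (x 1) - fstar" using lower by simp
    finally show ?thesis using c K by (simp add: field_simps)
  qed
  have PL_bound: "f (x (K + 1)) - fstar \<le> (f (x 1) - fstar) * (1 - 2 * \<mu> * c) ^ K"
    if mu: "\<mu> > 0" "PL \<mu> f" and c: "c \<le> (\<Sum>k=1..K. s k) / K" for \<mu> c
  proof -
    have "f (x (Suc K)) - fstar \<le> (f (x 1) - fstar) * (1 - (2 * \<mu>) * c) ^ K"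
    proof (rule mean_contraction[where a = "\<lambda>k. f (x k) - fstar", OF _ _ \<open>K \<ge> 1\<close> _ _ c])
      fix k assume k: "k \<in> {1..K}"
      \<comment> \<open>The gap is strictly positive: a gradient step from \<open>x k\<close>, where
        the gradient is nonzero, still ends no lower than \<open>fstar\<close>.\<close>
      have "f (x k) - N k / (2 * L) \<ge> fstar"
        unfolding N_def using gradient_step_descent[OF L(2,1)] lower by (rule order_trans[rotated])
      moreover have "N k / (2 * L) > 0" using N[OF k] L by simp
      ultimately show "0 < f (x k) - fstar" by linarith
      \<comment> \<open>PL bounds \<open>N k\<close> below by a multiple of the gap, so the decrease
        \<open>s k * N k\<close> is at least the fraction \<open>2 * \<mu> * s k\<close> of
        it.\<close>
      have "f (x k) - fstar \<le> 1 / (2 * \<mu>) * N k"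
        using mu(2) by (simp add: PL_def N_def fstar_def)
      then have "2 * \<mu> * (f (x k) - fstar) \<le> N k" using mu(1) by (simp add: field_simps)
      from mult_left_mono[OF this s0[OF k]] decrease[OF k]
      show "f (x (Suc k)) - fstar \<le> (f (x k) - fstar) * (1 - 2 * \<mu> * s k)"
        by (simp add: algebra_simps)
    qed (use mu lower in auto)
    then show ?thesis by simp
  qed
  \<comment> \<open>Truncation at 0 costs nothing: as \<open>f (x k)\<close> never increases, the
    mean of the \<open>s k\<close> is nonnegative.\<close>
  have max_le: "max (D Q) 0 \<le> (\<Sum>k=1..K. s k) / K" if "Q \<in> \<P>" for Q
    using D_le[OF that] s0 by (auto intro!: divide_nonneg_nonneg sum_nonneg)
  \<comment> \<open>With benchmark \<open>?I\<close>, equal to \<open>P 1\<close>, distance and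
    regularizer vanish, and each gain is that of a plain gradient step, at least 1/(2L).\<close>
  have baseline: "1 / (2 * L) \<le> (\<Sum>k=1..K. s k) / K" if "P 1 = ?I"
  proof -
    have "1 / (2 * L) \<le> gain ?I k" if k: "k \<in> {1..K}" for k
    proof -
      have "N k / (2 * L) \<le> f (x k) - f (x k - ?I *v gradient f (x k))"
        using gradient_step_descent[OF L(2,1), of "x k"]
        by (simp add: N_def scaleR_matrix_vector_assoc[symmetric])
      from divide_right_mono[OF this, of "N k"] N[OF k] show ?thesis
        by (simp add: gain_def hyper_def N_def[symmetric] minus_divide_left)
    qed
    from sum_mono[of "{1..K}", OF this] have "1 / (2 * L) \<le> D ?I"
      using K that by (simp add: D_def field_simps)
    with D_le[of ?I] P1 that show ?thesis by simp
  qed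
  have "(MIN k\<in>{1..K}. N k) \<le> 2 * L * (f (x 1) - fstar) / real K" if "P 1 = ?I"
    using min_bound[OF _ baseline[OF that]] L by (simp add: mult_ac)
  \<comment> \<open>The rate 1/(2L) times \<open>2 * \<mu>\<close> is the inverse condition
    number.\<close>
  moreover have "f (x (K + 1)) - fstar \<le> (f (x 1) - fstar) * (1 - 1 / (L / \<mu>)) ^ K"
    if "P 1 = ?I" "\<mu> > 0" "PL \<mu> f" for \<mu>
    using PL_bound[OF that(2,3) baseline[OF that(1)]] by simp
  ultimately show ?thesis
    unfolding Let_def fstar_def[symmetric] N_def[symmetric] gain_def[symmetric] D_def[symmetric]
    using min_bound[OF _ D_le] PL_bound[OF _ _ max_le] by blast
qed

end
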